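(* Let $k\ge 2$ and let $n\ge 2$ be even. Then the digraph $\mathrm{DPillar}_{n,k}$ is node-symmetric; that is, for any two distinct nodes $src$ and $dst$ of $\mathrm{DPillar}_{n,k}$ there is an automorphism of $\mathrm{DPillar}_{n,k}$ mapping $src$ to $dst$.
   Context: For $k\ge 2$ and even $n\ge 2$, the digraph $\mathrm{DPillar}_{n,k}$ is defined as follows. Its nodes (servers) are the pairs $(c,v_{k-1}v_{k-2}\ldots v_0)$ with $0\le c\le k-1$ and $0\le v_i\le \frac n2-1$ for all $0\le i\le k-1$; $c$ is called the column-index and $v_{k-1}\ldots v_0$ the row-index, and $v_i$ is called the bit in position $i$. Column-indices and bit positions are taken modulo $k$. From a node $(c,v_{k-1}\ldots v_0)$ there are directed edges to the following nodes, where $*$ denotes an arbitrary value in $\{0,1,\ldots,\frac n2-1\}$: (i) clockwise edges (c-edges): to the node in column $c+1$ whose row-index is obtained by replacing $v_c$ with $*$; (ii) anti-clockwise edges (a-edges): to the node in column $c-1$ whose row-index is obtained by replacing $v_{c-1}$ with $*$; (iii) basic static edges (b-edges): to the node in column $c$ whose row-index is obtained by replacing $v_c$ with $*\ne v_c$; (iv) decremented static edges (d-edges): to the node in column $c$ whose row-index is obtained by replacing $v_{c-1}$ with $*\neq v_{c-1}$. There are no loops, and all edges come in oppositely oriented pairs. An automorphism of a (finite) digraph is a bijection $\varphi$ of the node-set onto itself such that if $(u,v)$ is an edge then $(\varphi(u),\varphi(v))$ is an edge. *)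

theory Defs
  imports Graph_Theory.Pair_Digraph "HOL-Library.FuncSet"
begin

text \<open>
  A row-index \<open>v\<^sub>k\<^sub>-\<^sub>1 \<dots> v\<^sub>0\<close> is an extensional function on the bit positions, \<open>v i\<close> being
  the bit in position \<open>i\<close>; replacing a bit is function update.
\<close>

definition dpillar_nodes :: "nat \<Rightarrow> nat \<Rightarrow> (nat \<times> (nat \<Rightarrow> nat)) set" where
  "dpillar_nodes n k = {..<k} \<times> ({..<k} \<rightarrow>\<^sub>E {..<n div 2})"

definition next_col :: "nat \<Rightarrow> nat \<Rightarrow> nat" where
  "next_col k c = (c + 1) mod k"

text \<open>\<open>k\<close> is added before decrementing because subtraction on naturals truncates.\<close>

definition prev_col :: "nat \<Rightarrow> nat \<Rightarrow> nat" where
  "prev_col k c = (c + k - 1) mod k"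

definition c_edges :: "nat \<Rightarrow> nat \<Rightarrow> (nat \<times> (nat \<Rightarrow> nat)) rel" where
  "c_edges n k = {((c, v), (next_col k c, v(c := x))) | c v x.
     (c, v) \<in> dpillar_nodes n k \<and> x < n div 2}"

definition a_edges :: "nat \<Rightarrow> nat \<Rightarrow> (nat \<times> (nat \<Rightarrow> nat)) rel" where
  "a_edges n k = {((c, v), (prev_col k c, v(prev_col k c := x))) | c v x.
     (c, v) \<in> dpillar_nodes n k \<and> x < n div 2}"

definition b_edges :: "nat \<Rightarrow> nat \<Rightarrow> (nat \<times> (nat \<Rightarrow> nat)) rel" where
  "b_edges n k = {((c, v), (c, v(c := x))) | c v x.
     (c, v) \<in> dpillar_nodes n k \<and> x < n div 2 \<and> x \<noteq> v c}"

definition d_edges :: "nat \<Rightarrow> nat \<Rightarrow> (nat \<times> (nat \<Rightarrow> nat)) rel" where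
  "d_edges n k = {((c, v), (c, v(prev_col k c := x))) | c v x.
     (c, v) \<in> dpillar_nodes n k \<and> x < n div 2 \<and> x \<noteq> v (prev_col k c)}"

text \<open>
  The edges form a set of ordered pairs, so for \<open>k = 2\<close> the c-edge and the a-edge joining
  \<open>(c, v)\<close> to \<open>(c + 1, v)\<close> are one edge.
\<close>

definition DPillar :: "nat \<Rightarrow> nat \<Rightarrow> (nat \<times> (nat \<Rightarrow> nat)) pair_pre_digraph" where
  "DPillar n k = \<lparr> pverts = dpillar_nodes n k,
     parcs = c_edges n k \<union> a_edges n k \<union> b_edges n k \<union> d_edges n k \<rparr>"

text \<open>
  Preservation of edges in one direction suffices for an automorphism because the digraphs
  considered are finite.
\<close>

definition digraph_automorphism :: "'a pair_pre_digraph \<Rightarrow> ('a \<Rightarrow> 'a) \<Rightarrow> bool" where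
  "digraph_automorphism G \<phi> \<longleftrightarrow> bij_betw \<phi> (pverts G) (pverts G) \<and>
     (\<forall>u v. (u, v) \<in> parcs G \<longrightarrow> (\<phi> u, \<phi> v) \<in> parcs G)"

definition node_symmetric :: "'a pair_pre_digraph \<Rightarrow> bool" where
  "node_symmetric G \<longleftrightarrow> (\<forall>src \<in> pverts G. \<forall>dst \<in> pverts G. src \<noteq> dst \<longrightarrow>
     (\<exists>\<phi>. digraph_automorphism G \<phi> \<and> \<phi> src = dst))"

lemma next_prev_col:
  assumes "2 \<le> k" "c < k"
  shows "next_col k c < k" "prev_col k c < k" "next_col k c \<noteq> c" "prev_col k c \<noteq> c"
    "next_col k (prev_col k c) = c" "prev_col k (next_col k c) = c"
proof -
  have n: "next_col k c = (if c = k - 1 then 0 else c + 1)" if "c < k" for c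
    using that assms(1) by (auto simp: next_col_def)
  have p: "prev_col k c = (if c = 0 then k - 1 else c - 1)" if "c < k" for c
  proof (cases "c = 0")
    case False
    then have "c + k - 1 = (c - 1) + k" by simp
    then have "(c + k - 1) mod k = (c - 1) mod k" by (metis mod_add_self2)
    then show ?thesis using False that by (simp add: prev_col_def)
  qed (use assms in \<open>simp add: prev_col_def\<close>)
  show a: "next_col k c < k" "prev_col k c < k" "next_col k c \<noteq> c" "prev_col k c \<noteq> c"
    using assms by (auto simp: n p)
  show "next_col k (prev_col k c) = c" "prev_col k (next_col k c) = c"
    using assms a by (auto simp: n p)
qed

lemma dpillar_node_upd:
  assumes "(c, v) \<in> dpillar_nodes n k" "c' < k" "i < k" "x < n div 2"
  shows "(c', v(i := x)) \<in> dpillar_nodes n k"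
  using assms by (auto simp: dpillar_nodes_def PiE_iff extensional_def)

lemma DPillar_edges_in_nodes:
  assumes "2 \<le> k"
  shows "parcs (DPillar n k) \<subseteq> pverts (DPillar n k) \<times> pverts (DPillar n k)"
proof -
  have "c < k" if "(c, v) \<in> dpillar_nodes n k" for c v
    using that by (simp add: dpillar_nodes_def)
  then show ?thesis
    by (auto simp: DPillar_def c_edges_def a_edges_def b_edges_def d_edges_def
        intro!: dpillar_node_upd next_prev_col[OF assms])
qed

lemma DPillar_sym:
  assumes k: "2 \<le> k"
  shows "sym (parcs (DPillar n k))"
proof (rule symI)
  fix p q assume pq: "(p, q) \<in> parcs (DPillar n k)"
  obtain c v where p: "p = (c, v)" by (cases p)
  have N: "(c, v) \<in> dpillar_nodes n k" "q \<in> dpillar_nodes n k"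
    using DPillar_edges_in_nodes[OF k, of n] pq p by (auto simp: DPillar_def)
  then have c: "c < k" and v: "\<And>i. i < k \<Longrightarrow> v i < n div 2"
    by (auto simp: dpillar_nodes_def PiE_iff)
  note col = next_prev_col[OF k c]
  consider "(p, q) \<in> c_edges n k" | "(p, q) \<in> a_edges n k" | "(p, q) \<in> b_edges n k"
    | "(p, q) \<in> d_edges n k"
    using pq by (auto simp: DPillar_def)
  then have "(q, p) \<in> c_edges n k \<union> a_edges n k \<union> b_edges n k \<union> d_edges n k"
  proof cases
    case 1
    then obtain x where q: "q = (next_col k c, v(c := x))" by (auto simp: c_edges_def p)
    have "(q, p) \<in> a_edges n k"
      unfolding a_edges_def mem_Collect_eq p q
      by (rule exI[of _ "next_col k c"], rule exI[of _ "v(c := x)"], rule exI[of _ "v c"])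
        (use N v[OF c] q col in auto)
    then show ?thesis by blast
  next
    case 2
    then obtain x where q: "q = (prev_col k c, v(prev_col k c := x))"
      by (auto simp: a_edges_def p)
    have "(q, p) \<in> c_edges n k"
      unfolding c_edges_def mem_Collect_eq p q
      by (rule exI[of _ "prev_col k c"], rule exI[of _ "v(prev_col k c := x)"],
          rule exI[of _ "v (prev_col k c)"]) (use N v col q in auto)
    then show ?thesis by blast
  next
    case 3
    then obtain x where q: "q = (c, v(c := x))" "x \<noteq> v c" by (auto simp: b_edges_def p)
    have "(q, p) \<in> b_edges n k"
      unfolding b_edges_def mem_Collect_eq p q
      by (rule exI[of _ c], rule exI[of _ "v(c := x)"], rule exI[of _ "v c"])
        (use N v[OF c] q in auto)
    then show ?thesis by blast
  next
    case 4
    then obtain x where q: "q = (c, v(prev_col k c := x))" "x \<noteq> v (prev_col k c)"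
      by (auto simp: d_edges_def p)
    have "(q, p) \<in> d_edges n k"
      unfolding d_edges_def mem_Collect_eq p q
      by (rule exI[of _ c], rule exI[of _ "v(prev_col k c := x)"],
          rule exI[of _ "v (prev_col k c)"]) (use N v col q in auto)
    then show ?thesis by blast
  qed
  then show "(q, p) \<in> parcs (DPillar n k)" by (simp add: DPillar_def)
qed

lemma DPillar_no_loops:
  assumes k: "2 \<le> k"
  shows "(p, p) \<notin> parcs (DPillar n k)"
proof -
  have c: "c < k" if "(c, v) \<in> dpillar_nodes n k" for c v
    using that by (simp add: dpillar_nodes_def)
  have upd: "v = v(i := x) \<longleftrightarrow> x = v i" for v :: "nat \<Rightarrow> nat" and i x
    by (metis fun_upd_same fun_upd_triv)
  have "(p, p) \<notin> c_edges n k"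
    unfolding c_edges_def by (auto dest: next_prev_col(3)[OF k c, THEN not_sym])
  moreover have "(p, p) \<notin> a_edges n k"
    unfolding a_edges_def by (auto dest: next_prev_col(4)[OF k c, THEN not_sym])
  moreover have "(p, p) \<notin> b_edges n k" "(p, p) \<notin> d_edges n k"
    unfolding b_edges_def d_edges_def by (auto simp: upd)
  ultimately show ?thesis by (simp add: DPillar_def)
qed

lemma finite_dpillar_nodes: "finite (dpillar_nodes n k)"
  by (simp add: dpillar_nodes_def finite_PiE)

text \<open>Finite, without loops, and with all edges in oppositely oriented pairs.\<close>

lemma pair_graph_DPillar:
  assumes k: "2 \<le> k"
  shows "pair_graph (DPillar n k)"
proof -
  have fv: "finite (pverts (DPillar n k))"
    by (simp add: DPillar_def finite_dpillar_nodes)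
  have fa: "finite (parcs (DPillar n k))"
    using finite_subset[OF DPillar_edges_in_nodes[OF k]] fv by blast
  have ss: "symmetric (with_proj (DPillar n k))"
    using DPillar_sym[OF k, of n] by (simp add: symmetric_def arcs_ends_conv)
  show ?thesis
  proof unfold_locales
    fix e assume e: "e \<in> parcs (DPillar n k)"
    show "fst e \<in> pverts (DPillar n k)" "snd e \<in> pverts (DPillar n k)"
      using e DPillar_edges_in_nodes[OF k, of n] by auto
    show "fst e \<noteq> snd e"
      using e DPillar_no_loops[OF k] by (metis prod.collapse)
  qed (fact fv fa ss)+
qed

end

theory Submission
  imports Defs
begin

text \<open>
  Rotating the columns together with the bit positions preserves all four kinds of edges, and so
  does permuting the values of each bit separately. A rotation takes the column of \<open>src\<close> to that
  of \<open>dst\<close>, after which a transposition at each position corrects the row-index.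
\<close>

text \<open>The map \<open>r'\<close> is meant as the inverse of \<open>r\<close>: the bit arriving
  at position \<open>j\<close> comes from position \<open>r' j\<close>, and
  \<open>\<sigma> j\<close> then acts on its value. Thus \<open>\<sigma>\<close> is indexed by the
  new position. The restriction keeps row-indices extensional.\<close>

definition relabel ::
    "nat \<Rightarrow> (nat \<Rightarrow> nat) \<Rightarrow> (nat \<Rightarrow> nat) \<Rightarrow> (nat \<Rightarrow> nat \<Rightarrow> nat) \<Rightarrow> nat \<times> (nat \<Rightarrow> nat) \<Rightarrow> nat \<times> (nat \<Rightarrow> nat)"
  where "relabel k r r' \<sigma> = (\<lambda>(c, v). (r c, \<lambda>j\<in>{..<k}. \<sigma> j (v (r' j))))"

text \<open>Every edge replaces a single bit and possibly moves the column, so this one computation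
  serves all four kinds of edges.\<close>

lemma relabel_upd:
  assumes "i < k" "r i < k" "r' (r i) = i" "\<And>j. j < k \<Longrightarrow> r (r' j) = j"
  shows "relabel k r r' \<sigma> (c', v(i := x))
    = (r c', (snd (relabel k r r' \<sigma> (c, v)))(r i := \<sigma> (r i) x))"
proof -
  have "(\<lambda>j\<in>{..<k}. \<sigma> j ((v(i := x)) (r' j)))
      = (\<lambda>j\<in>{..<k}. \<sigma> j (v (r' j)))(r i := \<sigma> (r i) x)"
  proof
    fix j
    show "(\<lambda>j\<in>{..<k}. \<sigma> j ((v(i := x)) (r' j))) j
        = ((\<lambda>j\<in>{..<k}. \<sigma> j (v (r' j)))(r i := \<sigma> (r i) x)) j"
    proof (cases "j = r i")
      case True
      then show ?thesis using assms(2,3) by simp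
    next
      case False
      \<comment> \<open>If \<open>r' j = i\<close>, applying \<open>r\<close> would give
        \<open>j = r i\<close>. Outside \<open>{..<k}\<close> both sides are
        \<open>undefined\<close>.\<close>
      then have "r' j \<noteq> i" if "j < k" using assms(4)[OF that] by auto
      then show ?thesis using False by simp
    qed
  qed
  then show ?thesis by (simp add: relabel_def)
qed

text \<open>Commuting with \<open>next_col\<close> makes columns and the positions changed by an
  edge move in step; injectivity of \<open>\<sigma> j\<close> keeps a changed bit changed, as static
  edges demand.\<close>

lemma digraph_automorphism_relabel:
  assumes k: "2 \<le> k"
    and r: "\<And>i. i < k \<Longrightarrow> r i < k" "\<And>i. i < k \<Longrightarrow> r' i < k"
    and inv: "\<And>i. i < k \<Longrightarrow> r' (r i) = i" "\<And>i. i < k \<Longrightarrow> r (r' i) = i"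
    and nxt: "\<And>i. i < k \<Longrightarrow> r (next_col k i) = next_col k (r i)"
    and \<sigma>: "\<And>j x. j < k \<Longrightarrow> x < n div 2 \<Longrightarrow> \<sigma> j x < n div 2"
    and inj: "\<And>j. j < k \<Longrightarrow> inj_on (\<sigma> j) {..<n div 2}"
  shows "digraph_automorphism (DPillar n k) (relabel k r r' \<sigma>)"
proof -
  let ?f = "relabel k r r' \<sigma>"
  \<comment> \<open>Apply \<open>nxt\<close> at \<open>prev_col k i\<close>, then cancel
    \<open>next_col\<close> with \<open>prev_col\<close>.\<close>
  have prv: "r (prev_col k i) = prev_col k (r i)" if "i < k" for i
    by (metis k next_prev_col(2,5,6) nxt r(1) that)
  have nodes: "?f p \<in> dpillar_nodes n k" if "p \<in> dpillar_nodes n k" for p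
  proof -
    obtain c v where p: "p = (c, v)" by (cases p)
    then have "c < k" "\<And>i. i < k \<Longrightarrow> v i < n div 2"
      using that by (auto simp: dpillar_nodes_def PiE_iff)
    then show ?thesis
      using r \<sigma> by (simp add: p relabel_def dpillar_nodes_def PiE_iff)
  qed
  \<comment> \<open>Injectivity is enough for a bijection, since the node-set is finite and mapped
    into itself.\<close>
  have "inj_on ?f (dpillar_nodes n k)"
  proof (rule inj_onI, clarify)
    fix c v d w
    assume N: "(c, v) \<in> dpillar_nodes n k" "(d, w) \<in> dpillar_nodes n k"
      and eq: "?f (c, v) = ?f (d, w)"
    have lt: "c < k" "d < k" "\<And>i. i < k \<Longrightarrow> v i < n div 2" "\<And>i. i < k \<Longrightarrow> w i < n div 2"
      and ext: "v \<in> extensional {..<k}" "w \<in> extensional {..<k}"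
      using N by (auto simp: dpillar_nodes_def PiE_iff)
    have "r c = r d"
      using eq by (simp add: relabel_def)
    from arg_cong[OF this, of r'] have "c = d"
      by (simp only: inv(1) lt(1,2))
    moreover have "v i = w i" if i: "i < k" for i
    proof -
      \<comment> \<open>Position \<open>r i\<close> of the image holds the relabelled bit
        \<open>i\<close>, because \<open>r' (r i) = i\<close>.\<close>
      from arg_cong[OF eq, of "\<lambda>p. snd p (r i)"]
      have "\<sigma> (r i) (v i) = \<sigma> (r i) (w i)"
        by (simp add: relabel_def i r(1) inv(1))
      from inj_onD[OF inj[OF r(1)[OF i]] this] show ?thesis
        by (simp add: lt(3,4) i)
    qed
    ultimately show "c = d \<and> v = w"
      using extensionalityI[OF ext] by simp
  qed
  moreover have "?f ` dpillar_nodes n k \<subseteq> dpillar_nodes n k"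
    using nodes by blast
  ultimately have "bij_betw ?f (dpillar_nodes n k) (dpillar_nodes n k)"
    by (simp add: bij_betw_def endo_inj_surj[OF finite_dpillar_nodes])
  moreover have "(?f p, ?f q) \<in> parcs (DPillar n k)" if e: "(p, q) \<in> parcs (DPillar n k)" for p q
  proof -
    obtain c v where p: "p = (c, v)" by (cases p)
    have N: "(c, v) \<in> dpillar_nodes n k"
      using e DPillar_edges_in_nodes[OF k, of n] p by (auto simp: DPillar_def)
    then have c: "c < k" and v: "\<And>i. i < k \<Longrightarrow> v i < n div 2"
      by (auto simp: dpillar_nodes_def PiE_iff)
    define w where "w = snd (?f (c, v))"
    have fp: "?f (c, v) = (r c, w)"
      by (simp add: w_def relabel_def)
    have M: "(r c, w) \<in> dpillar_nodes n k"
      using nodes[OF N] fp by simp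
    have upd: "?f (c', v(i := x)) = (r c', w(r i := \<sigma> (r i) x))" if "i < k" for c' i x
      unfolding w_def using that r inv by (intro relabel_upd) auto
    have w: "w (r i) = \<sigma> (r i) (v i)" if "i < k" for i
      using that r inv by (simp add: w_def relabel_def)
    \<comment> \<open>This is the side condition of b- and d-edges at the image node.\<close>
    have ne: "\<sigma> (r i) x \<noteq> w (r i)" if "i < k" "x < n div 2" "x \<noteq> v i" for i x
    proof
      assume "\<sigma> (r i) x = w (r i)"
      then have "\<sigma> (r i) x = \<sigma> (r i) (v i)"
        by (simp only: w[OF that(1)])
      from inj_onD[OF inj[OF r(1)[OF that(1)]] this] show False
        using that v by simp
    qed
    have pc: "prev_col k c < k"
      using next_prev_col(2)[OF k c] .
    \<comment> \<open>Edges leaving column \<open>c\<close> change only position \<open>c\<close> or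
      \<open>prev_col k c\<close>; the new values there stay in range.\<close>
    note new = \<sigma>[OF r(1)[OF c]] \<sigma>[OF r(1)[OF pc]]
    consider x where "q = (next_col k c, v(c := x))" "x < n div 2"
      | x where "q = (prev_col k c, v(prev_col k c := x))" "x < n div 2"
      | x where "q = (c, v(c := x))" "x < n div 2" "x \<noteq> v c"
      | x where "q = (c, v(prev_col k c := x))" "x < n div 2" "x \<noteq> v (prev_col k c)"
      using e by (auto simp: DPillar_def c_edges_def a_edges_def b_edges_def d_edges_def p)
    then show ?thesis
    proof cases
      case 1
      then have "(?f p, ?f q) \<in> c_edges n k"
        using M new by (auto simp: c_edges_def p fp upd[OF c] nxt[OF c])
      then show ?thesis by (simp add: DPillar_def)
    next
      case 2
      then have "(?f p, ?f q) \<in> a_edges n k"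
        using M new by (auto simp: a_edges_def p fp upd[OF pc] prv[OF c])
      then show ?thesis by (simp add: DPillar_def)
    next
      case 3
      then have "(?f p, ?f q) \<in> b_edges n k"
        using M new ne[OF c] by (auto simp: b_edges_def p fp upd[OF c])
      then show ?thesis by (simp add: DPillar_def)
    next
      case 4
      then have "(?f p, ?f q) \<in> d_edges n k"
        using M new ne[OF pc] by (auto simp: d_edges_def p fp upd[OF pc] prv[OF c])
      then show ?thesis by (simp add: DPillar_def)
    qed
  qed
  ultimately show ?thesis
    by (simp add: digraph_automorphism_def DPillar_def)
qed

theorem corollary2:
  fixes n k :: nat
  assumes "k \<ge> 2" and "n \<ge> 2" and "even n"
  shows "node_symmetric (DPillar n k)"
  unfolding node_symmetric_def
proof (intro ballI impI)
  fix src dst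
  assume "src \<in> pverts (DPillar n k)" "dst \<in> pverts (DPillar n k)"
  moreover obtain c v d w where p: "src = (c, v)" "dst = (d, w)"
    by (cases src, cases dst)
  ultimately have lt: "c < k" "d < k" "\<And>i. i < k \<Longrightarrow> v i < n div 2" "\<And>i. i < k \<Longrightarrow> w i < n div 2"
    and ext: "w \<in> extensional {..<k}"
    by (auto simp: DPillar_def dpillar_nodes_def PiE_iff)
  \<comment> \<open>Shifts by \<open>d - c\<close> and \<open>c - d\<close> modulo \<open>k\<close>,
    with \<open>k\<close> added to avoid truncated subtraction; together they shift by
    \<open>2 * k\<close>, hence are mutually inverse.\<close>
  define r where "r i = (i + (d + (k - c))) mod k" for i
  define r' where "r' i = (i + (c + (k - d))) mod k" for i
  \<comment> \<open>Swaps the bit of \<open>src\<close> that the rotation brings to position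
    \<open>j\<close> with the bit wanted there; both are below \<open>n div 2\<close>, so the range
    is preserved.\<close>
  define \<sigma> where "\<sigma> j = transpose (v (r' j)) (w j)" for j
  have r: "r i < k" "r' i < k" for i
    using lt by (auto simp: r_def r'_def)
  have cancel: "(i + (d + (k - c)) + (c + (k - d))) mod k = i"
    "(i + (c + (k - d)) + (d + (k - c))) mod k = i" if "i < k" for i
  proof -
    have "i + (d + (k - c)) + (c + (k - d)) = i + 2 * k"
      "i + (c + (k - d)) + (d + (k - c)) = i + 2 * k"
      using lt by auto
    then show "(i + (d + (k - c)) + (c + (k - d))) mod k = i"
      "(i + (c + (k - d)) + (d + (k - c))) mod k = i"
      using that by (simp_all only: mod_mult_self1 mod_less)
  qed
  have inv: "r' (r i) = i" "r (r' i) = i" if "i < k" for i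
    using cancel[OF that] by (simp_all add: r_def r'_def mod_add_left_eq)
  have "digraph_automorphism (DPillar n k) (relabel k r r' \<sigma>)"
  proof (rule digraph_automorphism_relabel)
    show "r (next_col k i) = next_col k (r i)" for i
      by (simp add: r_def next_col_def mod_simps)
    show "\<sigma> j x < n div 2" if "j < k" "x < n div 2" for j x
      using that lt r by (auto simp: \<sigma>_def transpose_def)
    show "inj_on (\<sigma> j) {..<n div 2}" for j
      unfolding \<sigma>_def by (rule inj_on_transpose)
  qed (use assms r inv in auto)
  moreover have "relabel k r r' \<sigma> src = dst"
  proof -
    have "c + (d + (k - c)) = d + k"
      using lt by simp
    then have "r c = d"
      using lt by (simp add: r_def)
    moreover have "(\<lambda>j\<in>{..<k}. \<sigma> j (v (r' j))) = w"
      \<comment> \<open>Only positions below \<open>k\<close> need comparing, and there the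
        transposition sends \<open>v (r' j)\<close> to \<open>w j\<close>.\<close>
      by (rule extensionalityI[OF restrict_extensional ext]) (simp add: \<sigma>_def)
    ultimately show ?thesis
      by (simp add: relabel_def p)
  qed
  ultimately show "\<exists>\<phi>. digraph_automorphism (DPillar n k) \<phi> \<and> \<phi> src = dst"
    by blast
qed

end
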